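(* Let $n$ be a non-negative integer, let $p\in\mathbb{C}$ with $\Re(p)>0$, let $z\in\mathbb{C}\setminus\{0\}$ with $-\pi<\arg z\le\pi$, and let $\kappa,\mu\in\mathbb{C}$ with $2\mu\notin\{-1,-2,\ldots\}$ and $\mu\pm\kappa+\frac12\notin\{0,-1,-2,\ldots\}$. Then $$M_{\kappa,\mu}^{(p,n)}(z)=z^{\mu+\frac12}e^{-z/2}\sum_{k=0}^n\frac{(n+k)!\,(2p)^{-k}}{(n-k)!\,k!}\,\frac{(\mu-\kappa+\frac12)_k\,(\mu+\kappa+\frac12)_k}{(2\mu+1)_{2k}}\;\Phi_p\left(\mu-\kappa+k+\tfrac12;\,2\mu+2k+1;\,z\right).$$
   Context: $(a)_n=\Gamma(a+n)/\Gamma(a)$ is the Pochhammer symbol. $B(x,y)=\Gamma(x)\Gamma(y)/\Gamma(x+y)$ is the Beta function ($x,y\ne 0,-1,-2,\ldots$), and $K_\lambda$ is the modified Bessel function of the second kind. Complex powers of $z$ are principal ($-\pi<\arg z\le\pi$). For $\Re(p)>0$, $\nu\ge 0$, the extended Beta function is $$B_{p,\nu}(x,y)=\sqrt{\frac{2p}{\pi}}\int_0^1 t^{x-\frac32}(1-t)^{y-\frac32}K_{\nu+\frac12}\left(\frac{p}{t(1-t)}\right)dt.$$ The $(p,\nu)$-extended confluent hypergeometric function is $$\Phi_{p,\nu}(b;c;z)=\sum_{m=0}^\infty\frac{B_{p,\nu}(b+m,c-b)}{B(b,c-b)}\frac{z^m}{m!}=\frac{1}{B(b,c-b)}\sqrt{\frac{2p}{\pi}}\int_0^1t^{b-\frac32}(1-t)^{c-b-\frac32}e^{zt}K_{\nu+\frac12}\left(\frac{p}{t(1-t)}\right)dt.$$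 The $(p,\nu)$-extended Whittaker function is $$M_{\kappa,\mu}^{(p,\nu)}(z)=z^{\mu+\frac12}e^{-z/2}\,\Phi_{p,\nu}(\mu-\kappa+\tfrac12;2\mu+1;z).$$ The $p$-extended confluent hypergeometric function is, for $\Re(p)>0$, $$\Phi_p(b;c;z)=\frac{1}{B(b,c-b)}\int_0^1t^{b-1}(1-t)^{c-b-1}\exp\left(zt-\frac{p}{t(1-t)}\right)dt.$$ *)

theory Defs
  imports "HOL-Analysis.Analysis"
begin

definition Bessel_I :: "complex \<Rightarrow> complex \<Rightarrow> complex" where
  "Bessel_I \<nu> z =
     (z / 2) powr \<nu> * (\<Sum>k. (z\<^sup>2 / 4) ^ k * rGamma (\<nu> + of_nat k + 1) / fact k)"

text \<open>
  Modified Bessel function of the second kind, on its principal branch. At integer orders the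
  quotient is of the form \<open>0 / 0\<close> and is replaced by its limit in the order.
\<close>

definition Bessel_K :: "complex \<Rightarrow> complex \<Rightarrow> complex" where
  "Bessel_K \<nu> z =
     (let Q = (\<lambda>a. of_real pi / 2 * (Bessel_I (- a) z - Bessel_I a z) / sin (a * of_real pi))
      in if \<nu> \<in> \<int> then Lim (at \<nu>) Q else Q \<nu>)"

definition ext_Beta :: "complex \<Rightarrow> real \<Rightarrow> complex \<Rightarrow> complex \<Rightarrow> complex" where
  "ext_Beta p \<nu> x y =
     csqrt (2 * p / of_real pi) *
     (LINT t:{0<..<1}|lborel.
        of_real t powr (x - 3 / 2) * of_real (1 - t) powr (y - 3 / 2) *
        Bessel_K (of_real \<nu> + 1 / 2) (p / of_real (t * (1 - t))))"

definition ext_confluent :: "complex \<Rightarrow> real \<Rightarrow> complex \<Rightarrow> complex \<Rightarrow> complex \<Rightarrow> complex" where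
  "ext_confluent p \<nu> b c z =
     (\<Sum>m. ext_Beta p \<nu> (b + of_nat m) (c - b) / Beta b (c - b) * (z ^ m / fact m))"

definition ext_Whittaker :: "complex \<Rightarrow> real \<Rightarrow> complex \<Rightarrow> complex \<Rightarrow> complex \<Rightarrow> complex" where
  "ext_Whittaker p \<nu> \<kappa> \<mu> z =
     z powr (\<mu> + 1 / 2) * exp (- z / 2) * ext_confluent p \<nu> (\<mu> - \<kappa> + 1 / 2) (2 * \<mu> + 1) z"

definition p_confluent :: "complex \<Rightarrow> complex \<Rightarrow> complex \<Rightarrow> complex \<Rightarrow> complex" where
  "p_confluent p b c z =
     1 / Beta b (c - b) *
     (LINT t:{0<..<1}|lborel.
        of_real t powr (b - 1) * of_real (1 - t) powr (c - b - 1) *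
        exp (z * of_real t - p / of_real (t * (1 - t))))"

end

theory Submission
  imports Defs
begin

text \<open>
  At half-odd order the Bessel function is elementary:
  \<open>K\<^bsub>n + 1/2\<^esub>(w) = \<surd>(\<pi> / (2w)) e\<^sup>-\<^sup>w \<Sum>\<^sub>k (n + k)! / (k! (n - k)!) (2w)\<^sup>-\<^sup>k\<close>, because both sides satisfy the same
  three-term recurrence in \<open>n\<close>. With \<open>w = p / (t (1 - t))\<close> the square root cancels the prefactor and
  the half powers of \<open>t\<close> and \<open>1 - t\<close>, and the \<open>k\<close>-th term raises both Beta parameters by \<open>k\<close>. The
  quotient \<open>B(b + k, c - b + k) / B(b, c - b)\<close> supplies the Pochhammer symbols.
\<close>

section \<open>The entire series behind \<open>Bessel_I\<close>: 0F1 divided by Gamma\<close>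

definition rGamma_series_fun :: "complex \<Rightarrow> complex \<Rightarrow> complex" where
  "rGamma_series_fun a x = (\<Sum>k. x ^ k * rGamma (a + of_nat k) / fact k)"

text \<open>Ratio test. Since \<open>rGamma s = s * rGamma (s + 1)\<close>, the reciprocal Gamma
  factor does not grow in norm once \<open>norm s\<close> is at least 1, and
  \<open>norm x / (k + 1)\<close> is at most 1/2 for large \<open>k\<close>. The threshold
  \<open>N\<close> forces both \<open>norm a + 1 \<le> k\<close> and
  \<open>2 * norm x \<le> k\<close>.\<close>

lemma summable_rGamma_series_fun:
  fixes a x :: complex
  shows "summable (\<lambda>k. x ^ k * rGamma (a + of_nat k) / fact k)"
proof (rule summable_ratio_test[where c = "1/2" and N = "nat \<lceil>2 * norm x\<rceil> + nat \<lceil>norm a\<rceil> + 1"])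
  fix k :: nat
  assume k: "nat \<lceil>2 * norm x\<rceil> + nat \<lceil>norm a\<rceil> + 1 \<le> k"
  have "2 * norm x + norm a + 1 \<le> real (nat \<lceil>2 * norm x\<rceil> + nat \<lceil>norm a\<rceil> + 1)"
    using real_nat_ceiling_ge[of "2 * norm x"] real_nat_ceiling_ge[of "norm a"]
    by (simp only: of_nat_add of_nat_1 add_mono)
  also have "\<dots> \<le> real k"
    using k by (simp only: of_nat_le_iff)
  finally have k': "2 * norm x + norm a + 1 \<le> real k" .
  have kx: "2 * norm x \<le> real k" and ka: "norm a + 1 \<le> real k"
    using k' norm_ge_zero[of a] norm_ge_zero[of x] by linarith+
  let ?r = "norm (rGamma (a + of_nat k + 1))"
  have "norm (of_nat k :: complex) \<le> norm (a + of_nat k) + norm a"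
    by (metis add_diff_cancel_left' norm_triangle_ineq4)
  hence "1 \<le> norm (a + of_nat k)"
    using ka by simp
  hence "1 * ?r \<le> norm (a + of_nat k) * ?r"
    by (rule mult_right_mono) simp
  hence r: "?r \<le> norm (rGamma (a + of_nat k))"
    by (simp flip: norm_mult add: rGamma_plus1)
  have "norm (x ^ Suc k * rGamma (a + of_nat (Suc k)) / fact (Suc k)) =
        norm x / (real k + 1) * (norm x ^ k * ?r / fact k)"
  proof -
    have "a + of_nat (Suc k) = a + of_nat k + 1" by simp
    moreover have "norm (fact (Suc k) :: complex) = (real k + 1) * fact k"
      by (simp only: norm_fact) simp
    ultimately show ?thesis
      by (simp only: norm_mult norm_divide norm_power power_Suc) simp
  qed
  also have "\<dots> \<le> 1 / 2 * (norm x ^ k * norm (rGamma (a + of_nat k)) / fact k)"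
    using kx r by (intro mult_mono divide_right_mono mult_left_mono) (auto simp: field_simps)
  finally show "norm (x ^ Suc k * rGamma (a + of_nat (Suc k)) / fact (Suc k)) \<le>
      1 / 2 * norm (x ^ k * rGamma (a + of_nat k) / fact k)"
    by (simp add: norm_mult norm_divide norm_power norm_fact)
qed simp

text \<open>Split \<open>rGamma (a + k) = (a + k) * rGamma (a + k + 1)\<close>: the summand
  \<open>a\<close> gives the series at \<open>a + 1\<close>; the summand \<open>k\<close> cancels
  against \<open>fact k\<close> and, after an index shift, gives the series at
  \<open>a + 2\<close>.\<close>

lemma rGamma_series_fun_rec:
  "rGamma_series_fun a x = a * rGamma_series_fun (a + 1) x + x * rGamma_series_fun (a + 2) x"
proof -
  define f where "f = (\<lambda>b k. x ^ k * rGamma (b + of_nat k) / (fact k :: complex))"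
  have f: "f b sums rGamma_series_fun b x" for b
    unfolding rGamma_series_fun_def f_def by (intro summable_sums summable_rGamma_series_fun)
  have "(\<lambda>k. x * f (a + 2) k) sums (x * rGamma_series_fun (a + 2) x)"
    by (intro sums_mult f)
  moreover have "x * f (a + 2) k = of_nat (Suc k) * f (a + 1) (Suc k)" for k
    by (simp add: f_def add_ac del: of_nat_Suc) (simp add: add_ac)
  ultimately have "(\<lambda>k. of_nat (Suc k) * f (a + 1) (Suc k)) sums (x * rGamma_series_fun (a + 2) x)"
    by simp
  \<comment> \<open>The new term of index 0 carries the factor 0, so the sum is unchanged.\<close>
  from sums_Suc[OF this] have "(\<lambda>k. of_nat k * f (a + 1) k) sums (x * rGamma_series_fun (a + 2) x)"
    by simp
  from sums_add[OF sums_mult[OF f[of "a + 1"], of a] this]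
  have "(\<lambda>k. a * f (a + 1) k + of_nat k * f (a + 1) k) sums
      (a * rGamma_series_fun (a + 1) x + x * rGamma_series_fun (a + 2) x)" .
  moreover have "a * f (a + 1) k + of_nat k * f (a + 1) k = f a k" for k
    using rGamma_plus1[of "a + of_nat k"] by (simp add: f_def add_ac flip: distrib_right add_divide_distrib)
  ultimately show ?thesis
    using f[of a] by (simp add: sums_unique2)
qed

section \<open>Parameters 1/2 and 3/2: hyperbolic cosine and sine\<close>

lemma rGamma_half_plus_nat:
  "rGamma (1 / 2 + of_nat k :: complex) = 4 ^ k * fact k / (fact (2 * k) * of_real (sqrt pi))"
proof (induction k)
  case 0
  have "rGamma (1 / 2 :: complex) = 1 / of_real (sqrt pi)"
    by (simp only: rGamma_inverse_Gamma Gamma_one_half_complex inverse_eq_divide)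
  then show ?case by simp
next
  case (Suc k)
  have nz: "(1 / 2 + of_nat k :: complex) \<noteq> 0" "(1 + 2 * of_nat k :: complex) \<noteq> 0"
    by (simp_all add: complex_eq_iff)
  have "rGamma (1 / 2 + of_nat (Suc k) :: complex) = rGamma (1 / 2 + of_nat k) / (1 / 2 + of_nat k)"
    using rGamma_plus1[of "1 / 2 + of_nat k :: complex"] nz(1) by (simp add: add_ac field_simps)
  also have "\<dots> = 4 ^ Suc k * fact (Suc k) / (fact (2 * Suc k) * of_real (sqrt pi))"
  proof -
    have "of_nat (Suc k) \<noteq> (0 :: complex)" by (rule of_nat_neq_0)
    moreover have "fact (2 * Suc k) = (2 * (of_nat (Suc k)) * (1 + 2 * of_nat k) * fact (2 * k) :: complex)"
      by (simp add: algebra_simps)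
    moreover have "1 / 2 + of_nat k = (1 + 2 * of_nat k) / (2 :: complex)"
      by simp
    \<comment> \<open>A cancellation kept apart from the factorials: \<open>M\<close> stands for
      \<open>1 + 2 * k\<close>, and \<open>K\<close>, standing for \<open>k + 1\<close>, drops
      out.\<close>
    moreover have "P * F / (G * r) / (M / 2) = 4 * P * (K * F) / (2 * K * M * G * r)"
      if "K \<noteq> 0" for P F G r M K :: complex
      using that by (simp add: divide_simps)
    ultimately show ?thesis
      unfolding Suc by (simp only: fact_Suc[of k] power_Suc)
  qed
  finally show ?case .
qed

text \<open>The \<open>4 ^ k\<close> in \<open>rGamma_half_plus_nat\<close> cancels the powers of 2
  in the argument, which leaves the even part of the exponential series.\<close>

lemma rGamma_series_fun_half:
  "rGamma_series_fun (1 / 2) ((w / 2)\<^sup>2) = cosh w / of_real (sqrt pi)"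
proof -
  have "(\<lambda>k. if even k then w ^ k /\<^sub>R fact k else 0) sums cosh w"
    by (rule cosh_converges)
  \<comment> \<open>Reindexing along the strictly increasing map \<open>k\<close> to
    \<open>2 * k\<close> skips only zero terms.\<close>
  hence "(\<lambda>k. if even (2 * k) then w ^ (2 * k) /\<^sub>R fact (2 * k) else 0) sums cosh w"
    by (rule sums_mono_reindex[THEN iffD2, rotated 2]) (auto simp: strict_mono_def)
  hence "(\<lambda>k. w ^ (2 * k) /\<^sub>R fact (2 * k)) sums cosh w"
    by simp
  from sums_divide[OF this, of "of_real (sqrt pi)"]
  have "(\<lambda>k. ((w / 2)\<^sup>2) ^ k * rGamma (1 / 2 + of_nat k) / fact k) sums (cosh w / of_real (sqrt pi))"
    unfolding rGamma_half_plus_nat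
    by (rule sums_cong[THEN iffD1, rotated])
       (simp add: scaleR_conv_of_real power_divide power_mult divide_simps)
  thus ?thesis
    by (simp add: rGamma_series_fun_def sums_iff)
qed

text \<open>Dividing \<open>rGamma (1 / 2 + k)\<close> by \<open>1 / 2 + k\<close> completes
  \<open>fact (2 * k)\<close> to \<open>fact (2 * k + 1)\<close>, which yields the odd part of the
  exponential series with one power of \<open>w\<close> divided out.\<close>

lemma rGamma_series_fun_three_halves:
  assumes "w \<noteq> 0"
  shows "rGamma_series_fun (3 / 2) ((w / 2)\<^sup>2) = 2 * sinh w / (w * of_real (sqrt pi))"
proof -
  have "(\<lambda>k. if even k then 0 else w ^ k /\<^sub>R fact k) sums sinh w"
    by (rule sinh_converges)
  hence "(\<lambda>k. if even (2 * k + 1) then 0 else w ^ (2 * k + 1) /\<^sub>R fact (2 * k + 1)) sums sinh w"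
    by (rule sums_mono_reindex[THEN iffD2, rotated 2]) (auto simp: strict_mono_def elim!: oddE)
  hence "(\<lambda>k. w ^ (2 * k + 1) /\<^sub>R fact (2 * k + 1)) sums sinh w"
    by (simp del: power_Suc fact_Suc)
  from sums_mult[OF this, of "2 / (w * of_real (sqrt pi))"]
  have "(\<lambda>k. ((w / 2)\<^sup>2) ^ k * rGamma (3 / 2 + of_nat k) / fact k) sums
      (2 / (w * of_real (sqrt pi)) * sinh w)"
  proof (rule sums_cong[THEN iffD1, rotated])
    fix k
    have nz: "(1 / 2 + of_nat k :: complex) \<noteq> 0" "(1 + 2 * of_nat k :: complex) \<noteq> 0"
      by (simp_all add: complex_eq_iff)
    have g: "rGamma (3 / 2 + of_nat k :: complex) = rGamma (1 / 2 + of_nat k) / (1 / 2 + of_nat k)"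
      using rGamma_plus1[of "1 / 2 + of_nat k :: complex"] nz(1) by (simp add: add_ac field_simps)
    have f: "of_real (fact (2 * k + 1)) = (1 + 2 * of_nat k) * (fact (2 * k) :: complex)"
      by (simp add: algebra_simps)
    show "2 / (w * of_real (sqrt pi)) * (w ^ (2 * k + 1) /\<^sub>R fact (2 * k + 1)) =
       ((w / 2)\<^sup>2) ^ k * rGamma (3 / 2 + of_nat k) / fact k"
      unfolding g rGamma_half_plus_nat scaleR_conv_of_real of_real_inverse f
      using nz assms by (simp add: power_divide power_mult divide_simps)
  qed
  thus ?thesis
    by (simp add: rGamma_series_fun_def sums_iff)
qed

section \<open>Bessel functions of half-odd order and Bessel polynomials\<close>

lemma Bessel_I_eq: "Bessel_I \<nu> w = (w / 2) powr \<nu> * rGamma_series_fun (\<nu> + 1) ((w / 2)\<^sup>2)"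
  by (simp add: Bessel_I_def rGamma_series_fun_def power_divide add_ac)

text \<open>The Krall-Frink Bessel polynomial of degree \<open>n\<close>, taken at
  \<open>2 * y\<close>; below, \<open>y = 1 / (2 * w)\<close>.\<close>

definition Bessel_poly :: "nat \<Rightarrow> complex \<Rightarrow> complex" where
  "Bessel_poly n y = (\<Sum>k\<le>n. fact (n + k) / (fact (n - k) * fact k) * y ^ k)"

text \<open>Comparison of the coefficients of \<open>y ^ Suc k\<close>: all three are polynomial
  multiples of one quotient of factorials \<open>X\<close>, which leaves a polynomial identity in
  \<open>n\<close> and \<open>k\<close>.\<close>

lemma Bessel_poly_rec:
  "Bessel_poly (Suc (Suc n)) y = Bessel_poly n y + 2 * (2 * of_nat n + 3) * y * Bessel_poly (Suc n) y"
proof -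
  \<comment> \<open>Extending the coefficients by zero lets sums of different degrees share one
    range.\<close>
  define c where "c = (\<lambda>n k. if k \<le> n then fact (n + k) / (fact (n - k) * fact k) else 0 :: complex)"
  have B: "Bessel_poly m y = (\<Sum>k\<le>N. c m k * y ^ k)" if "m \<le> N" for m N
    unfolding Bessel_poly_def c_def using that
    by (intro sum.mono_neutral_cong_left) auto
  have c0: "c m 0 = 1" for m
    by (simp add: c_def)
  have rec: "c (Suc (Suc n)) (Suc k) = c n (Suc k) + 2 * (2 * of_nat n + 3) * c (Suc n) k"
    if "k \<le> Suc n" for k
  proof -
    have "\<exists>j. Suc n = k + j"
      using that by (rule le_Suc_ex)
    then obtain j where n: "Suc n = k + j" ..
    define X where "X = (fact (n + Suc k) / (fact (Suc k) * fact j) :: complex)"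
    have e: "Suc (Suc n) + Suc k = Suc (Suc (n + Suc k))" "Suc n + k = n + Suc k"
      "Suc (Suc n) - Suc k = j" "Suc n - k = j"
      using n by simp_all
    have nz: "of_nat (Suc k) \<noteq> (0 :: complex)"
      by (rule of_nat_neq_0)
    have "c (Suc (Suc n)) (Suc k) = of_nat (n + Suc k + 2) * of_nat (n + Suc k + 1) * X"
      using that unfolding c_def e X_def fact_Suc[of "Suc (n + Suc k)"] fact_Suc[of "n + Suc k"]
      by (simp add: add_ac mult_ac)
    moreover have "c (Suc n) k = of_nat (Suc k) * X"
      using that nz unfolding c_def e X_def fact_Suc[of k] by (simp del: of_nat_Suc)
    \<comment> \<open>The factor \<open>j * (j - 1)\<close> vanishes at \<open>j = 0\<close> and
      \<open>j = 1\<close>, exactly the cases in which \<open>Suc k\<close> exceeds \<open>n\<close>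
      and the coefficient is zero by convention.\<close>
    moreover have "c n (Suc k) = of_nat j * (of_nat j - 1) * X"
    proof (cases "j \<ge> 2")
      case True
      then obtain i where i: "j = Suc (Suc i)"
        using le_Suc_ex[OF True] by (auto simp: numeral_2_eq_2)
      have "n - Suc k = i" "Suc k \<le> n"
        using n i by simp_all
      moreover have "of_nat (Suc (Suc i)) * of_nat (Suc i) \<noteq> (0 :: complex)"
        by (metis mult_eq_0_iff of_nat_neq_0)
      moreover have "fact j = of_nat (Suc (Suc i)) * of_nat (Suc i) * (fact i :: complex)"
        "of_nat j - 1 = (of_nat (Suc i) :: complex)"
        by (simp_all add: i algebra_simps)
      ultimately show ?thesis
        unfolding c_def X_def i[symmetric] by (simp del: of_nat_Suc fact_Suc)
    next
      case False
      hence "j = 0 \<or> j = 1" by auto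
      thus ?thesis using n by (auto simp: c_def)
    qed
    moreover have "(of_nat j :: complex) = of_nat n + 1 - of_nat k"
      using arg_cong[OF n, of "of_nat :: nat \<Rightarrow> complex"] by (simp add: algebra_simps)
    ultimately have "c (Suc (Suc n)) (Suc k) = of_nat (n + Suc k + 2) * of_nat (n + Suc k + 1) * X"
      "c (Suc n) k = of_nat (Suc k) * X"
      "c n (Suc k) = (of_nat n + 1 - of_nat k) * (of_nat n - of_nat k) * X"
      by simp_all
    thus ?thesis
      by (simp only:) (simp add: algebra_simps)
  qed
  have "Bessel_poly (Suc (Suc n)) y = 1 + (\<Sum>k\<le>Suc n. c (Suc (Suc n)) (Suc k) * y ^ Suc k)"
    by (subst B[OF order.refl], subst sum.atMost_Suc_shift) (simp add: c0)
  also have "(\<Sum>k\<le>Suc n. c (Suc (Suc n)) (Suc k) * y ^ Suc k) =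
      (\<Sum>k\<le>Suc n. c n (Suc k) * y ^ Suc k + 2 * (2 * of_nat n + 3) * y * (c (Suc n) k * y ^ k))"
    by (intro sum.cong) (simp_all add: rec algebra_simps)
  also have "1 + \<dots> = (1 + (\<Sum>k\<le>Suc n. c n (Suc k) * y ^ Suc k)) +
      2 * (2 * of_nat n + 3) * y * (\<Sum>k\<le>Suc n. c (Suc n) k * y ^ k)"
    by (simp only: sum.distrib sum_distrib_left add.assoc)
  also have "1 + (\<Sum>k\<le>Suc n. c n (Suc k) * y ^ Suc k) = Bessel_poly n y"
    by (subst B[of n "Suc (Suc n)"], simp, subst sum.atMost_Suc_shift) (simp add: c0)
  also note B[of "Suc n" "Suc n", OF order.refl, symmetric]
  finally show ?thesis .
qed

lemma sin_half_odd_pi: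
  "sin ((of_nat n + 1 / 2) * of_real pi :: complex) = (-1) ^ n"
proof -
  have "sin ((of_nat n + 1 / 2) * of_real pi :: complex) = of_real (sin ((real n + 1 / 2) * pi))"
    by (simp flip: sin_of_real)
  also have "sin ((real n + 1 / 2) * pi) = (-1) ^ n"
    by (simp add: distrib_right sin_add)
  finally show ?thesis by simp
qed

text \<open>The left side is the difference of \<open>Bessel_I\<close> at orders
  \<open>-(n + 1/2)\<close> and \<open>n + 1/2\<close> with the common power
  \<open>(w / 2) powr (- 1 / 2)\<close> removed; the sign is that of the sine in
  \<open>Bessel_K\<close>. Two-step induction: \<open>rGamma_series_fun_rec\<close> gives the left
  side the recurrence of \<open>Bessel_poly\<close>, and the start is
  \<open>cosh w - sinh w = exp (- w)\<close>.\<close>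

lemma Bessel_I_difference_half:
  fixes w :: complex
  assumes "w \<noteq> 0"
  shows "(-1) ^ n * (rGamma_series_fun (1 / 2 - of_nat n) ((w / 2)\<^sup>2) / (w / 2) ^ n -
            (w / 2) ^ Suc n * rGamma_series_fun (3 / 2 + of_nat n) ((w / 2)\<^sup>2)) =
         exp (- w) / of_real (sqrt pi) * Bessel_poly n (1 / (2 * w))"
proof -
  define q where "q = w / 2"
  define E where "E = (\<lambda>a. rGamma_series_fun a (q\<^sup>2))"
  define D where "D = (\<lambda>n. (-1) ^ n * (E (1 / 2 - of_nat n) / q ^ n - q ^ Suc n * E (3 / 2 + of_nat n)))"
  have w: "w = 2 * q" and q: "q \<noteq> 0"
    using assms by (simp_all add: q_def)
  have rec: "E a = a * E (a + 1) + q\<^sup>2 * E (a + 2)" for a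
    unfolding E_def by (rule rGamma_series_fun_rec)
  have E1: "E (1 / 2) = cosh w / of_real (sqrt pi)"
    unfolding E_def q_def by (rule rGamma_series_fun_half)
  have E3: "q * E (3 / 2) = sinh w / of_real (sqrt pi)"
    unfolding E_def q_def using assms by (subst rGamma_series_fun_three_halves) simp_all
  have D0: "E (1 / 2) - q * E (3 / 2) = exp (- w) / of_real (sqrt pi)"
    unfolding E1 E3 by (simp add: cosh_minus_sinh flip: diff_divide_distrib)
  \<comment> \<open>The series recurrence lowers the parameter of the first summand and raises that
    of the second. With \<open>w = 2 * q\<close>, the coefficient agrees with that of
    \<open>Bessel_poly_rec\<close> at \<open>1 / (2 * w)\<close>.\<close>
  have D_rec: "D (Suc (Suc n)) = D n + (2 * of_nat n + 3) / (2 * q) * D (Suc n)" for n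
  proof -
    have e1: "E (1 / 2 - of_nat (Suc (Suc n))) =
        (- 3 / 2 - of_nat n) * E (1 / 2 - of_nat (Suc n)) + q\<^sup>2 * E (1 / 2 - of_nat n)"
      using rec[of "1 / 2 - of_nat (Suc (Suc n))"] by (simp add: algebra_simps)
    have e2: "q\<^sup>2 * E (3 / 2 + of_nat (Suc (Suc n))) =
        E (3 / 2 + of_nat n) - (3 / 2 + of_nat n) * E (3 / 2 + of_nat (Suc n))"
      using rec[of "3 / 2 + of_nat n"] by (simp add: algebra_simps)
    have e3: "q ^ Suc (Suc (Suc n)) * E (3 / 2 + of_nat (Suc (Suc n))) =
        q ^ Suc n * (q\<^sup>2 * E (3 / 2 + of_nat (Suc (Suc n))))"
      by (simp add: power2_eq_square)
    have s: "(-1) ^ Suc (Suc n) = ((-1) ^ n :: complex)" "(-1) ^ Suc n = - ((-1) ^ n :: complex)"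
      by simp_all
    show ?thesis
      unfolding D_def e1 e3 unfolding e2 s
      using q by (simp add: divide_simps power2_eq_square) (simp add: algebra_simps)
  qed
  have "D n = exp (- w) / of_real (sqrt pi) * Bessel_poly n (1 / (2 * w))"
  proof (induction n rule: induct_nat_012)
    case 0
    show ?case using D0 by (simp add: D_def Bessel_poly_def)
  next
    case 1
    \<comment> \<open>The second base case is also reduced to the parameters 1/2 and 3/2, where the
      closed forms are known.\<close>
    have e1: "E (- 1 / 2) = - 1 / 2 * E (1 / 2) + q\<^sup>2 * E (3 / 2)"
      using rec[of "- 1 / 2"] by simp
    have e2: "q\<^sup>2 * E (5 / 2) = E (1 / 2) - E (3 / 2) / 2"
      using rec[of "1 / 2"] by simp
    have "D 1 = (E (1 / 2) - q * E (3 / 2)) * (1 + 1 / w)"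
    proof -
      have "D 1 = - (E (- 1 / 2) / q - q\<^sup>2 * E (5 / 2))"
        by (simp add: D_def power2_eq_square)
      also have "\<dots> = (E (1 / 2) - q * E (3 / 2)) * (1 + 1 / w)"
        unfolding e1 e2 using q by (simp add: w field_simps power2_eq_square)
      finally show ?thesis .
    qed
    also have "1 + 1 / w = Bessel_poly 1 (1 / (2 * w))"
      by (simp add: Bessel_poly_def)
    finally show ?case by (simp add: D0)
  next
    case (ge2 n)
    show ?case
      unfolding D_rec ge2 Bessel_poly_rec using q by (simp add: w field_simps)
  qed
  thus ?thesis
    by (simp only: D_def E_def q_def)
qed

text \<open>A half-odd order is not an integer, so \<open>Bessel_K\<close> is the plain quotient and
  no limit in the order occurs. Both powers of \<open>w / 2\<close> differ from \<open>h\<close> by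
  integer powers, so \<open>h\<close> factors out on the principal branch.\<close>

lemma Bessel_K_half_odd:
  fixes w :: complex
  assumes "w \<noteq> 0"
  shows "Bessel_K (of_nat n + 1 / 2) w =
    of_real (sqrt pi) / 2 * (w / 2) powr (- 1 / 2) * exp (- w) * Bessel_poly n (1 / (2 * w))"
proof -
  define q where "q = w / 2"
  define h where "h = q powr (- 1 / 2)"
  have q: "q \<noteq> 0" using assms by (simp add: q_def)
  have nint: "(of_nat n + 1 / 2 :: complex) \<notin> \<int>"
  proof
    assume "(of_nat n + 1 / 2 :: complex) \<in> \<int>"
    hence "(of_nat n + 1 / 2 - of_nat n :: complex) \<in> \<int>"
      by (rule Ints_diff) simp
    thus False
      using fraction_not_in_Ints[of 2 1, where ?'a = complex] by simp
  qed
  have "- (of_nat n + 1 / 2) = (- 1 / 2 - of_nat n :: complex)"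
    by simp
  hence h1: "q powr (- (of_nat n + 1 / 2)) = h / q ^ n"
    using q by (simp only: powr_diff h_def) simp
  have "q powr (of_nat n + 1 / 2) = q powr (- 1 / 2 + of_nat (Suc n))"
    by (simp add: algebra_simps)
  hence h2: "q powr (of_nat n + 1 / 2) = h * q ^ Suc n"
    by (simp only: powr_add h_def powr_complexpow[OF q])
  have "Bessel_K (of_nat n + 1 / 2) w = of_real pi / 2 * h *
      ((-1) ^ n * (rGamma_series_fun (1 / 2 - of_nat n) (q\<^sup>2) / q ^ n -
            q ^ Suc n * rGamma_series_fun (3 / 2 + of_nat n) (q\<^sup>2)))"
    unfolding Bessel_K_def Let_def Bessel_I_eq q_def[symmetric] h1 h2 sin_half_odd_pi
    using nint q by (cases "even n") (simp_all add: field_simps)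
  also have "\<dots> = of_real pi / 2 * h * (exp (- w) / of_real (sqrt pi) * Bessel_poly n (1 / (2 * w)))"
    by (simp only: q_def Bessel_I_difference_half[OF assms])
  also have "(of_real pi :: complex) = of_real (sqrt pi) * of_real (sqrt pi)"
    by (simp flip: of_real_mult)
  finally show ?thesis
    by (simp add: h_def q_def field_simps)
qed

section \<open>Expansion of the extended Beta integrand\<close>

text \<open>Both arguments are positive real multiples of \<open>p\<close>. Positive factors split
  off \<open>Ln\<close> without a branch correction, so the two halves of \<open>Ln p\<close> cancel
  for complex \<open>p\<close> and a positive real number remains.\<close>

lemma csqrt_times_powr_neg_half:
  assumes "p \<noteq> 0" "u > 0"
  shows "csqrt (2 * p / of_real pi) * (of_real (sqrt pi) / 2 * (p / of_real u / 2) powr (- 1 / 2)) =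
    of_real (sqrt u)"
proof -
  have e1: "2 * p / of_real pi = of_real (2 / pi) * p" and e2: "p / of_real u / 2 = of_real (1 / (2 * u)) * p"
    by simp_all
  have "csqrt (2 * p / of_real pi) * (p / of_real u / 2) powr (- 1 / 2) =
      exp (of_real (ln (2 / pi) / 2 - ln (1 / (2 * u)) / 2))"
  proof -
    have "Ln (2 * p / of_real pi) = of_real (ln (2 / pi)) + Ln p"
      unfolding e1 using assms by (subst Ln_times_of_real) (simp_all add: Ln_of_real del: of_real_divide)
    moreover have "Ln (p / of_real u / 2) = of_real (ln (1 / (2 * u))) + Ln p"
      unfolding e2 using assms by (subst Ln_times_of_real) (simp_all add: Ln_of_real del: of_real_divide)
    ultimately have "csqrt (2 * p / of_real pi) * (p / of_real u / 2) powr (- 1 / 2) =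
        exp ((of_real (ln (2 / pi)) + Ln p) / 2) * exp (- 1 / 2 * (of_real (ln (1 / (2 * u))) + Ln p))"
      using assms csqrt_exp_Ln[of "2 * p / of_real pi"] by (simp add: powr_def)
    also have "\<dots> = exp ((of_real (ln (2 / pi)) + Ln p) / 2 + - 1 / 2 * (of_real (ln (1 / (2 * u))) + Ln p))"
      by (rule exp_add[symmetric])
    also have "(of_real (ln (2 / pi)) + Ln p) / 2 + - 1 / 2 * (of_real (ln (1 / (2 * u))) + Ln p) =
        of_real (ln (2 / pi) / 2 - ln (1 / (2 * u)) / 2)"
      unfolding of_real_diff by (simp add: add_divide_distrib)
    finally show ?thesis
      unfolding e1 e2 .
  qed
  also have "ln (2 / pi) / 2 - ln (1 / (2 * u)) / 2 = ln (sqrt (4 * u / pi))"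
    using assms by (simp add: ln_sqrt ln_div ln_mult flip: diff_divide_distrib)
       (use ln_mult[of 2 2] in simp)
  also have "exp (of_real (ln (sqrt (4 * u / pi)))) = (of_real (2 * sqrt u / sqrt pi) :: complex)"
    using assms by (simp add: exp_of_real real_sqrt_mult real_sqrt_divide)
  finally have "csqrt (2 * p / of_real pi) * (of_real (sqrt pi) / 2 * (p / of_real u / 2) powr (- 1 / 2)) =
      of_real (sqrt pi) / 2 * of_real (2 * sqrt u / sqrt pi)"
    by (metis (no_types, lifting) mult.left_commute)
  thus ?thesis by simp
qed

text \<open>The square root of \<open>t * (1 - t)\<close> raises both exponents by 1/2, and each
  factor \<open>1 / (2 * w) = t * (1 - t) / (2 * p)\<close> raises both by 1.\<close>

lemma ext_Beta_integrand_half_odd: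
  assumes "p \<noteq> 0" "0 < t" "t < 1"
  shows "csqrt (2 * p / of_real pi) *
      (of_real t powr (x - 3 / 2) * of_real (1 - t) powr (y - 3 / 2) *
       Bessel_K (of_real (real n) + 1 / 2) (p / of_real (t * (1 - t)))) =
    (\<Sum>k\<le>n. fact (n + k) / (fact (n - k) * fact k * (2 * p) ^ k) *
       (of_real t powr (x + of_nat k - 1) * of_real (1 - t) powr (y + of_nat k - 1) *
        exp (- (p / of_real (t * (1 - t))))))"
proof -
  define u where "u = t * (1 - t)"
  define T S where "T = (of_real t :: complex)" and "S = (of_real (1 - t) :: complex)"
  have u: "u > 0" using assms by (simp add: u_def)
  have TS: "T \<noteq> 0" "S \<noteq> 0" using assms by (simp_all add: T_def S_def)
  have w: "p / of_real u \<noteq> 0" using assms u by simp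
  have "of_real s powr (1 / 2) = complex_of_real (sqrt s)" if "s \<ge> 0" for s
    using that powr_of_real[of s "1 / 2"] by (simp add: powr_half_sqrt)
  hence half: "of_real (sqrt u) = T powr (1 / 2) * S powr (1 / 2)"
    using assms by (simp add: u_def T_def S_def real_sqrt_mult del: of_real_diff)
  \<comment> \<open>Stated for any nonzero base, as it serves both \<open>t\<close> with
    \<open>x\<close> and \<open>1 - t\<close> with \<open>y\<close>.\<close>
  have T1: "T powr (x + of_nat k - 1) = T powr (x - 3 / 2) * T powr (1 / 2) * T ^ k"
    if "T \<noteq> 0" for x T :: complex and k
  proof -
    have "x + of_nat k - 1 = x - 3 / 2 + 1 / 2 + of_nat k" by (simp add: field_simps)
    thus ?thesis using that by (simp only: powr_add powr_complexpow simp_thms)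
  qed
  have y: "(1 / (2 * (p / of_real u))) ^ k = T ^ k * S ^ k / (2 * p) ^ k" for k
    by (simp add: u_def T_def S_def power_divide power_mult_distrib)
  have "csqrt (2 * p / of_real pi) * (T powr (x - 3 / 2) * S powr (y - 3 / 2) *
      Bessel_K (of_real (real n) + 1 / 2) (p / of_real u)) =
      csqrt (2 * p / of_real pi) * (of_real (sqrt pi) / 2 * (p / of_real u / 2) powr (- 1 / 2)) *
      (T powr (x - 3 / 2) * S powr (y - 3 / 2)) * (exp (- (p / of_real u)) * Bessel_poly n (1 / (2 * (p / of_real u))))"
    unfolding of_real_of_nat_eq Bessel_K_half_odd[OF w] by (simp only: mult_ac)
  also have "\<dots> = (T powr (x - 3 / 2) * T powr (1 / 2)) * (S powr (y - 3 / 2) * S powr (1 / 2)) *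
       exp (- (p / of_real u)) * Bessel_poly n (1 / (2 * (p / of_real u)))"
    unfolding csqrt_times_powr_neg_half[OF assms(1) u] half by (simp only: mult_ac)
  also have "\<dots> = (\<Sum>k\<le>n. fact (n + k) / (fact (n - k) * fact k * (2 * p) ^ k) *
       (T powr (x + of_nat k - 1) * S powr (y + of_nat k - 1) * exp (- (p / of_real u))))"
    unfolding Bessel_poly_def sum_distrib_left y T1[OF TS(1)] T1[OF TS(2)]
    by (intro sum.cong) (simp_all add: field_simps)
  finally show ?thesis
    by (simp only: u_def T_def S_def)
qed

section \<open>The p-extended Beta integral: integrability and power series in z\<close>

definition p_Beta_kernel :: "complex \<Rightarrow> complex \<Rightarrow> complex \<Rightarrow> real \<Rightarrow> complex" where
  "p_Beta_kernel p x y t =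
     of_real t powr (x - 1) * of_real (1 - t) powr (y - 1) * exp (- (p / of_real (t * (1 - t))))"

text \<open>Chaudhry's extended Beta function, which at \<open>p = 0\<close> becomes Euler's
  integral.\<close>

definition p_Beta :: "complex \<Rightarrow> complex \<Rightarrow> complex \<Rightarrow> complex" where
  "p_Beta p x y = (LINT t:{0<..<1}|lborel. p_Beta_kernel p x y t)"

text \<open>Raise \<open>s \<le> exp s\<close> with \<open>s = P * v / K\<close> to the power
  \<open>K\<close>.\<close>

lemma power_times_exp_minus_bound:
  fixes P v :: real
  assumes "P > 0" "v \<ge> 0" "K > 0"
  shows "v ^ K * exp (- (P * v)) \<le> (real K / P) ^ K"
proof -
  have "P * v / real K \<le> exp (P * v / real K)"
    using exp_ge_add_one_self[of "P * v / real K"] by linarith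
  hence "(P * v / real K) ^ K \<le> exp (P * v / real K) ^ K"
    using assms by (intro power_mono) auto
  also have "\<dots> = exp (P * v)"
    using assms by (simp flip: exp_of_nat_mult)
  finally show ?thesis
    using assms by (simp add: exp_minus power_divide power_mult_distrib field_simps)
qed

text \<open>Passing from \<open>s\<close> to a smaller \<open>u\<close> gives \<open>t\<close> and
  \<open>1 - t\<close> one common bound, with \<open>u = t * (1 - t)\<close>.\<close>

lemma norm_powr_unit_interval_le:
  fixes a :: complex
  assumes "0 < s" "s < 1" "0 < u" "u \<le> s" "\<bar>Re a\<bar> \<le> real N"
  shows "norm (of_real s powr a) \<le> (1 / u) ^ N"
proof -
  have "norm (of_real s powr a) = s powr Re a"
    using assms by (simp add: norm_powr_real_powr)
  also have "\<dots> \<le> s powr (- real N)"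
    using assms by (intro powr_mono') auto
  also have "\<dots> = (1 / s) ^ N"
    using assms by (simp add: powr_minus powr_realpow power_divide field_simps)
  also have "\<dots> \<le> (1 / u) ^ N"
    using assms by (intro power_mono) (auto simp: field_simps)
  finally show ?thesis .
qed

text \<open>The decay of \<open>exp (- Re p / u)\<close> with \<open>u = t * (1 - t)\<close> beats
  every power of \<open>1 / u\<close>, so the kernel stays bounded at both endpoints for all complex
  \<open>x\<close> and \<open>y\<close>.\<close>

lemma bounded_p_Beta_kernel:
  assumes "Re p > 0"
  shows "\<exists>B. \<forall>t\<in>{0<..<1}. norm (p_Beta_kernel p x y t) \<le> B"
proof -
  \<comment> \<open>\<open>N\<close> dominates both real exponents in absolute value;
    \<open>Suc\<close> keeps \<open>N + N\<close> positive for
    \<open>power_times_exp_minus_bound\<close>.\<close>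
  define N where "N = Suc (nat \<lceil>max \<bar>Re (x - 1)\<bar> \<bar>Re (y - 1)\<bar>\<rceil>)"
  have "max \<bar>Re (x - 1)\<bar> \<bar>Re (y - 1)\<bar> \<le> real N"
    using real_nat_ceiling_ge[of "max \<bar>Re (x - 1)\<bar> \<bar>Re (y - 1)\<bar>"]
    unfolding N_def of_nat_Suc by linarith
  hence N: "\<bar>Re (x - 1)\<bar> \<le> real N" "\<bar>Re (y - 1)\<bar> \<le> real N"
    by (simp_all only: max.bounded_iff)
  have "norm (p_Beta_kernel p x y t) \<le> (real (N + N) / Re p) ^ (N + N)" if "t \<in> {0<..<1}" for t
  proof -
    define u where "u = t * (1 - t)"
    have t: "0 < t" "t < 1" "0 < 1 - t" "1 - t < 1" using that by auto
    have u: "0 < u" "u \<le> t" "u \<le> 1 - t"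
      unfolding u_def using t by (intro mult_pos_pos mult_left_le mult_left_le_one_le; simp)+
    have v: "0 \<le> 1 / u" using u by simp
    have "norm (p_Beta_kernel p x y t) =
        norm (of_real t powr (x - 1)) * norm (of_real (1 - t) powr (y - 1)) * exp (- (Re p * (1 / u)))"
      unfolding p_Beta_kernel_def norm_mult u_def[symmetric] norm_exp_eq_Re
      by (simp add: Re_divide_of_real)
    also have "\<dots> \<le> (1 / u) ^ N * (1 / u) ^ N * exp (- (Re p * (1 / u)))"
      by (intro mult_right_mono mult_mono norm_powr_unit_interval_le t u N zero_le_power v) simp_all
    also have "\<dots> = (1 / u) ^ (N + N) * exp (- (Re p * (1 / u)))"
      by (simp only: power_add)
    also have "\<dots> \<le> (real (N + N) / Re p) ^ (N + N)"
      by (intro power_times_exp_minus_bound assms v) (simp add: N_def)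
    finally show ?thesis .
  qed
  thus ?thesis by (intro exI ballI)
qed

text \<open>Inside the interval \<open>t\<close> and \<open>1 - t\<close> are positive, hence off
  the branch cut of \<open>Ln\<close>, and \<open>powr\<close> is the exponential
  expression.\<close>

lemma continuous_on_p_Beta_kernel: "continuous_on {0<..<1} (p_Beta_kernel p x y)"
proof (rule continuous_on_eq)
  show "continuous_on {0<..<1} (\<lambda>t. exp ((x - 1) * Ln (of_real t)) * exp ((y - 1) * Ln (of_real (1 - t))) *
      exp (- (p / of_real (t * (1 - t)))))"
    by (auto intro!: continuous_intros simp: complex_nonpos_Reals_iff)
qed (auto simp: p_Beta_kernel_def powr_def)

lemma set_integrable_p_Beta_kernel:
  assumes "Re p > 0"
  shows "set_integrable lborel {0<..<1} (p_Beta_kernel p x y)"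
proof -
  obtain B where B: "\<And>t. t \<in> {0<..<1} \<Longrightarrow> norm (p_Beta_kernel p x y t) \<le> B"
    using bounded_p_Beta_kernel[OF assms] by blast
  have "(\<lambda>t. indicator {0<..<1} t *\<^sub>R p_Beta_kernel p x y t) \<in> borel_measurable borel"
    by (intro borel_measurable_continuous_on_indicator continuous_on_p_Beta_kernel) auto
  thus ?thesis
    unfolding set_integrable_def using B
    by (intro integrableI_bounded_set[where A = "{0<..<1}" and B = B]) (auto simp: indicator_def)
qed

lemma p_Beta_kernel_mult_power:
  assumes "t \<noteq> 0"
  shows "p_Beta_kernel p x y t * of_real t ^ m = p_Beta_kernel p (x + of_nat m) y t"
proof -
  have "of_real t powr (x + of_nat m - 1) = of_real t powr (x - 1) * (of_real t :: complex) ^ m"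
    using assms by (simp add: powr_diff powr_add)
  thus ?thesis
    by (simp add: p_Beta_kernel_def)
qed

text \<open>Expand \<open>exp (z * t)\<close> and integrate termwise; the factor
  \<open>t ^ m\<close> moves into the first Beta parameter.\<close>

lemma p_Beta_power_series_sums:
  assumes "Re p > 0"
  shows "(\<lambda>m. p_Beta p (x + of_nat m) y * (z ^ m / fact m)) sums
     (LINT t:{0<..<1}|lborel.
        of_real t powr (x - 1) * of_real (1 - t) powr (y - 1) *
        exp (z * of_real t - p / of_real (t * (1 - t))))"
proof -
  define g where "g = (\<lambda>t. indicator {0<..<1} t *\<^sub>R p_Beta_kernel p x y t)"
  define f where "f = (\<lambda>m t. indicator {0<..<1} t *\<^sub>R p_Beta_kernel p (x + of_nat m) y t * (z ^ m / fact m))"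
  \<comment> \<open>At \<open>t = 0\<close> both sides vanish through the indicator; elsewhere the
    kernel absorbs \<open>t ^ m\<close>.\<close>
  have f: "f m t = g t * ((z * of_real t) ^ m / fact m)" for m t
    by (cases "t = 0")
       (auto simp: f_def g_def power_mult_distrib indicator_def simp flip: p_Beta_kernel_mult_power)
  have int_f: "integrable lborel (f m)" for m
    unfolding f_def using set_integrable_p_Beta_kernel[OF assms, of "x + of_nat m" y]
    unfolding set_integrable_def by (rule integrable_mult_left)
  have int_g: "integrable lborel g"
    unfolding g_def using set_integrable_p_Beta_kernel[OF assms, of x y] by (simp add: set_integrable_def)
  \<comment> \<open>As \<open>t\<close> lies below 1, the terms are dominated by those of the series
    of \<open>exp (norm z)\<close> times \<open>norm (g t)\<close>. This gives both the pointwise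
    and the integrated summability that the interchange requires.\<close>
  have f_le: "norm (f m t) \<le> norm (g t) * (norm z ^ m / fact m)" for m t
  proof (cases "t \<in> {0<..<1}")
    case True
    hence "norm (z * of_real t) ^ m \<le> norm z ^ m"
      by (intro power_mono) (auto simp: norm_mult mult_left_le)
    thus ?thesis
      unfolding f norm_mult[of "g t"] norm_divide norm_power norm_fact
      by (intro mult_left_mono divide_right_mono) auto
  qed (simp add: f_def)
  have exp_summable: "summable (\<lambda>m. norm z ^ m / fact m)"
    using summable_exp[of "norm z"] by (simp add: divide_inverse mult.commute)
  have "(\<lambda>m. integral\<^sup>L lborel (f m)) sums (\<integral>t. (\<Sum>m. f m t) \<partial>lborel)"
  proof (rule sums_integral)
    show "AE t in lborel. summable (\<lambda>m. norm (f m t))"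
    proof (intro AE_I2)
      fix t
      show "summable (\<lambda>m. norm (f m t))"
        by (rule summable_comparison_test'[where g = "\<lambda>m. norm (g t) * (norm z ^ m / fact m)" and N = 0])
           (intro summable_mult exp_summable, simp only: real_norm_def abs_norm_cancel f_le)
    qed
    show "summable (\<lambda>m. \<integral>t. norm (f m t) \<partial>lborel)"
    proof (rule summable_comparison_test'[where N = 0])
      show "summable (\<lambda>m. (\<integral>t. norm (g t) \<partial>lborel) * (norm z ^ m / fact m))"
        by (intro summable_mult exp_summable)
      fix m :: nat
      have "(\<integral>t. norm (f m t) \<partial>lborel) \<le> (\<integral>t. norm (g t) * (norm z ^ m / fact m) \<partial>lborel)"
        using int_f int_g f_le by (intro integral_mono) auto
      thus "norm (\<integral>t. norm (f m t) \<partial>lborel) \<le> (\<integral>t. norm (g t) \<partial>lborel) * (norm z ^ m / fact m)"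
        by simp
    qed
  qed (rule int_f)
  moreover have "integral\<^sup>L lborel (f m) = p_Beta p (x + of_nat m) y * (z ^ m / fact m)" for m
    unfolding f_def p_Beta_def set_lebesgue_integral_def by (rule integral_mult_left_zero)
  moreover have "(\<Sum>m. f m t) = g t * exp (z * of_real t)" for t
  proof -
    have "(\<lambda>m. g t * ((z * of_real t) ^ m / fact m)) sums (g t * exp (z * of_real t))"
      using exp_converges[of "z * of_real t"]
      by (intro sums_mult) (simp add: scaleR_conv_of_real divide_inverse mult.commute)
    thus ?thesis
      unfolding f by (rule sums_unique[symmetric])
  qed
  moreover have "g t * exp (z * of_real t) = indicator {0<..<1} t *\<^sub>R
      (of_real t powr (x - 1) * of_real (1 - t) powr (y - 1) *
        exp (z * of_real t - p / of_real (t * (1 - t))))" for t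
    by (simp add: g_def p_Beta_kernel_def exp_diff exp_minus divide_inverse)
  ultimately show ?thesis
    by (simp add: set_lebesgue_integral_def)
qed

text \<open>Puts \<open>p_confluent\<close> into the series form of \<open>ext_confluent\<close>, so
  that the two can be compared term by term.\<close>

lemma p_confluent_sums:
  assumes "Re p > 0"
  shows "(\<lambda>m. p_Beta p (b + of_nat m) (c - b) / Beta b (c - b) * (z ^ m / fact m)) sums
           p_confluent p b c z"
  using sums_mult[OF p_Beta_power_series_sums[OF assms, of b "c - b" z], of "1 / Beta b (c - b)"]
  by (simp add: p_confluent_def)

section \<open>Shifted Beta values and comparison of the confluent series\<close>

text \<open>Each Pochhammer symbol is a quotient of Gamma values; shifting both arguments by
  \<open>k\<close> shifts their sum by \<open>2 * k\<close>.\<close>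

lemma Beta_add_nat:
  fixes x y :: complex
  assumes "x \<notin> \<int>\<^sub>\<le>\<^sub>0" "y \<notin> \<int>\<^sub>\<le>\<^sub>0" "x + y \<notin> \<int>\<^sub>\<le>\<^sub>0"
  shows "Beta (x + of_nat k) (y + of_nat k) =
    Beta x y * (pochhammer x k * pochhammer y k / pochhammer (x + y) (2 * k))"
proof -
  have e: "x + of_nat k + (y + of_nat k) = x + y + of_nat (2 * k)"
    by simp
  show ?thesis
    using assms unfolding Beta_def e by (simp add: pochhammer_Gamma Gamma_eq_zero_iff)
qed

lemma Beta_nonzero:
  fixes x y :: complex
  assumes "x \<notin> \<int>\<^sub>\<le>\<^sub>0" "y \<notin> \<int>\<^sub>\<le>\<^sub>0" "x + y \<notin> \<int>\<^sub>\<le>\<^sub>0"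
  shows "Beta x y \<noteq> 0"
  using assms by (simp add: Beta_def Gamma_eq_zero_iff)

lemma notin_nonpos_Ints_add_nat:
  fixes x :: "'a :: ring_char_0"
  assumes "x \<notin> \<int>\<^sub>\<le>\<^sub>0"
  shows "x + of_nat k \<notin> \<int>\<^sub>\<le>\<^sub>0"
  using assms nonpos_Ints_diff_Nats[of "x + of_nat k" "of_nat k"] by auto

text \<open>Integrates the pointwise expansion; each summand is integrable because
  \<open>Re p > 0\<close>, so the finite sum leaves the integral.\<close>

lemma ext_Beta_half_odd:
  assumes "Re p > 0"
  shows "ext_Beta p (real n) x y =
    (\<Sum>k\<le>n. fact (n + k) / (fact (n - k) * fact k * (2 * p) ^ k) *
       p_Beta p (x + of_nat k) (y + of_nat k))"
proof -
  define C where "C = (\<lambda>k. fact (n + k) / (fact (n - k) * fact k * (2 * p) ^ k))"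
  define K where "K = (\<lambda>k. p_Beta_kernel p (x + of_nat k) (y + of_nat k))"
  have p: "p \<noteq> 0" using assms by auto
  have int: "set_integrable lborel {0<..<1} (\<lambda>t. C k * K k t)" for k
    unfolding K_def by (intro set_integrable_mult_right set_integrable_p_Beta_kernel assms)
  have "ext_Beta p (real n) x y = (LINT t:{0<..<1}|lborel. (\<Sum>k\<le>n. C k * K k t))"
    unfolding ext_Beta_def set_integral_mult_right[symmetric]
  proof (rule set_lebesgue_integral_cong, simp, intro allI impI)
    fix t :: real
    assume t: "t \<in> {0<..<1}"
    show "csqrt (2 * p / of_real pi) *
        (of_real t powr (x - 3 / 2) * of_real (1 - t) powr (y - 3 / 2) *
         Bessel_K (of_real (real n) + 1 / 2) (p / of_real (t * (1 - t)))) = (\<Sum>k\<le>n. C k * K k t)"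
      unfolding C_def K_def p_Beta_kernel_def using t p by (intro ext_Beta_integrand_half_odd) auto
  qed
  also have "\<dots> = (\<Sum>k\<le>n. LINT t:{0<..<1}|lborel. C k * K k t)"
    using int unfolding set_lebesgue_integral_def set_integrable_def scaleR_sum_right
    by (intro Bochner_Integration.integral_sum) auto
  finally show ?thesis
    by (simp only: set_integral_mult_right C_def K_def p_Beta_def)
qed

text \<open>For fixed \<open>k\<close>, dividing by the shifted Beta value \<open>B k\<close> turns
  the terms in \<open>m\<close> into those of a \<open>p_confluent\<close> series, and
  \<open>B k / Beta b (c - b)\<close> leaves the Pochhammer factor. The finite sum over
  \<open>k\<close> then commutes with the series in \<open>m\<close>. The conditions on
  \<open>b\<close>, \<open>c - b\<close> and \<open>c\<close> make the Beta values nonzero.\<close>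

lemma ext_confluent_half_odd:
  assumes "Re p > 0" "b \<notin> \<int>\<^sub>\<le>\<^sub>0" "c - b \<notin> \<int>\<^sub>\<le>\<^sub>0" "c \<notin> \<int>\<^sub>\<le>\<^sub>0"
  shows "ext_confluent p (real n) b c z =
    (\<Sum>k\<le>n. fact (n + k) / (fact (n - k) * fact k * (2 * p) ^ k) *
       (pochhammer b k * pochhammer (c - b) k / pochhammer c (2 * k)) *
       p_confluent p (b + of_nat k) (c + 2 * of_nat k) z)"
proof -
  define C where "C = (\<lambda>k. fact (n + k) / (fact (n - k) * fact k * (2 * p) ^ k))"
  define r where "r = (\<lambda>k. pochhammer b k * pochhammer (c - b) k / pochhammer c (2 * k))"
  define B where "B = (\<lambda>k. Beta (b + of_nat k) (c - b + of_nat k))"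
  define T where "T = (\<lambda>k m. p_Beta p (b + of_nat k + of_nat m) (c - b + of_nat k) / B k * (z ^ m / fact m))"
  have B: "B k = Beta b (c - b) * r k" for k
    using Beta_add_nat[of b "c - b" k] assms by (simp add: B_def r_def)
  have "b + of_nat k + (c - b + of_nat k) = c + of_nat (2 * k)" for k
    by simp
  hence B_nz: "B k \<noteq> 0" for k
    unfolding B_def using assms by (intro Beta_nonzero) (simp_all only: notin_nonpos_Ints_add_nat not_False_eq_True)
  have B0: "Beta b (c - b) \<noteq> 0"
    using assms by (intro Beta_nonzero) simp_all
  have T: "T k sums p_confluent p (b + of_nat k) (c + 2 * of_nat k) z" for k
  proof -
    have "c + 2 * of_nat k - (b + of_nat k) = c - b + of_nat k"
      by (simp add: algebra_simps)
    thus ?thesis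
      using p_confluent_sums[OF assms(1), of "b + of_nat k" "c + 2 * of_nat k" z]
      by (simp only: T_def B_def)
  qed
  have "ext_Beta p (real n) (b + of_nat m) (c - b) / Beta b (c - b) * (z ^ m / fact m) =
      (\<Sum>k\<le>n. C k * r k * T k m)" for m
  proof -
    have "C k * r k * T k m =
        C k * p_Beta p (b + of_nat m + of_nat k) (c - b + of_nat k) / Beta b (c - b) * (z ^ m / fact m)" for k
      using B_nz[of k] B0 by (simp add: T_def B add_ac)
    thus ?thesis
      unfolding ext_Beta_half_odd[OF assms(1)] C_def sum_divide_distrib sum_distrib_right by simp
  qed
  moreover have "(\<lambda>m. \<Sum>k\<le>n. C k * r k * T k m) sums
      (\<Sum>k\<le>n. C k * r k * p_confluent p (b + of_nat k) (c + 2 * of_nat k) z)"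
    by (intro sums_sum sums_mult T)
  ultimately show ?thesis
    by (simp add: ext_confluent_def sums_iff C_def r_def)
qed

theorem theorem1:
  fixes n :: nat and p z \<kappa> \<mu> :: complex
  assumes "Re p > 0"
    and "z \<noteq> 0"
    and "\<And>j::nat. j \<ge> 1 \<Longrightarrow> 2 * \<mu> \<noteq> - of_nat j"
    and "\<mu> + \<kappa> + 1 / 2 \<notin> \<int>\<^sub>\<le>\<^sub>0"
    and "\<mu> - \<kappa> + 1 / 2 \<notin> \<int>\<^sub>\<le>\<^sub>0"
  shows "ext_Whittaker p (real n) \<kappa> \<mu> z =
    z powr (\<mu> + 1 / 2) * exp (- z / 2) *
    (\<Sum>k=0..n.
       fact (n + k) * (2 * p) powi (- int k) / (fact (n - k) * fact k) *
       (pochhammer (\<mu> - \<kappa> + 1 / 2) k * pochhammer (\<mu> + \<kappa> + 1 / 2) k /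
        pochhammer (2 * \<mu> + 1) (2 * k)) *
       p_confluent p (\<mu> - \<kappa> + of_nat k + 1 / 2) (2 * \<mu> + 2 * of_nat k + 1) z)"
proof -
  \<comment> \<open>Off by one: \<open>2 * \<mu> + 1 = - m\<close> means
    \<open>2 * \<mu> = - (m + 1)\<close>, which is excluded for every natural
    \<open>m\<close>.\<close>
  have c: "2 * \<mu> + 1 \<notin> \<int>\<^sub>\<le>\<^sub>0"
  proof
    assume "2 * \<mu> + 1 \<in> \<int>\<^sub>\<le>\<^sub>0"
    then obtain m where "2 * \<mu> + 1 = - of_nat m"
      by (elim nonpos_Ints_cases')
    hence "2 * \<mu> = - of_nat m - 1"
      by (simp only: eq_diff_eq)
    hence "2 * \<mu> = - of_nat (Suc m)"
      by simp
    with assms(3)[of "Suc m"] show False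
      by simp
  qed
  \<comment> \<open>The second Beta parameter \<open>c - b\<close>, source of the Pochhammer symbol
    with \<open>+ \<kappa>\<close>.\<close>
  have cb: "2 * \<mu> + 1 - (\<mu> - \<kappa> + 1 / 2) = \<mu> + \<kappa> + 1 / 2"
    by (simp add: field_simps)
  have "ext_confluent p (real n) (\<mu> - \<kappa> + 1 / 2) (2 * \<mu> + 1) z =
    (\<Sum>k\<le>n. fact (n + k) / (fact (n - k) * fact k * (2 * p) ^ k) *
       (pochhammer (\<mu> - \<kappa> + 1 / 2) k * pochhammer (\<mu> + \<kappa> + 1 / 2) k / pochhammer (2 * \<mu> + 1) (2 * k)) *
       p_confluent p (\<mu> - \<kappa> + 1 / 2 + of_nat k) (2 * \<mu> + 1 + 2 * of_nat k) z)"
    using ext_confluent_half_odd[of p "\<mu> - \<kappa> + 1 / 2" "2 * \<mu> + 1" n z] assms c unfolding cb by simp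
  also have "\<dots> = (\<Sum>k=0..n.
       fact (n + k) * (2 * p) powi (- int k) / (fact (n - k) * fact k) *
       (pochhammer (\<mu> - \<kappa> + 1 / 2) k * pochhammer (\<mu> + \<kappa> + 1 / 2) k /
        pochhammer (2 * \<mu> + 1) (2 * k)) *
       p_confluent p (\<mu> - \<kappa> + of_nat k + 1 / 2) (2 * \<mu> + 2 * of_nat k + 1) z)"
  proof (intro sum.cong)
    fix k
    have "fact (n + k) / (fact (n - k) * fact k * (2 * p) ^ k) =
        fact (n + k) * (2 * p) powi (- int k) / (fact (n - k) * fact k)"
      by (simp add: power_int_minus divide_inverse mult_ac)
    moreover have "\<mu> - \<kappa> + 1 / 2 + of_nat k = \<mu> - \<kappa> + of_nat k + 1 / 2"
      "2 * \<mu> + 1 + 2 * of_nat k = 2 * \<mu> + 2 * of_nat k + 1"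
      by simp_all
    ultimately show "fact (n + k) / (fact (n - k) * fact k * (2 * p) ^ k) *
       (pochhammer (\<mu> - \<kappa> + 1 / 2) k * pochhammer (\<mu> + \<kappa> + 1 / 2) k / pochhammer (2 * \<mu> + 1) (2 * k)) *
       p_confluent p (\<mu> - \<kappa> + 1 / 2 + of_nat k) (2 * \<mu> + 1 + 2 * of_nat k) z =
       fact (n + k) * (2 * p) powi (- int k) / (fact (n - k) * fact k) *
       (pochhammer (\<mu> - \<kappa> + 1 / 2) k * pochhammer (\<mu> + \<kappa> + 1 / 2) k /
        pochhammer (2 * \<mu> + 1) (2 * k)) *
       p_confluent p (\<mu> - \<kappa> + of_nat k + 1 / 2) (2 * \<mu> + 2 * of_nat k + 1) z"
      by (simp only:)
  qed auto
  finally show ?thesis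
    by (simp only: ext_Whittaker_def)
qed

end
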